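(* Let $a, b \in \mathbb{R}^+$ with $a \geq b$, and consider the rectangular grid with parameters $a,b$. For every $\ell \in \mathbb{R}^+$, $$\tau(\ell) = i^\ast + j^\ast - 1,$$ where $$i^\ast = \left\lceil \frac{3}{2} + \frac{b}{a}\,\operatorname{Re}\sqrt{\frac{\ell^2}{a^2+b^2} - \frac{1}{4}}\, \right\rceil, \qquad j^\ast = \left\lceil 1 + \frac{\sqrt{\ell^2 - (i^\ast-2)^2 a^2}}{b} \right\rceil .$$ The function $\tau:\mathbb{R}^+\to\mathbb{N}$ is piecewise constant and left-continuous, with unit-height jumps. A jump occurs at $\ell$ if and only if $\ell = \lambda(t)$ for some $t \in \mathbb{N}$, $t \geq 4$; and then $\tau(\ell) = t-1$ and $\lim_{\delta\to 0^+} \tau(\ell+\delta) = t$.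
   Context: $\mathbb{N}=\{1,2,3,\dots\}$ and $\mathbb{R}^+=(0,\infty)$. The grid with parameters $a,b\in\mathbb{R}^+$ consists of the lines $x=ka$ and $y=kb$, $k\in\mathbb{Z}$, in $\mathbb{R}^2$; its tiles are the rectangles $[ka,(k+1)a]\times[mb,(m+1)b]$, $k,m\in\mathbb{Z}$. A line segment visits a tile if it intersects the interior of the tile. For $\ell\in\mathbb{R}^+$, $\tau(\ell)$ is the maximum number of tiles visited by a line segment of length $\ell$, over all positions and orientations of the segment in the plane. For $t\in\mathbb{N}$, $\lambda(t)$ is the infimum of the lengths of all segments that visit at least $t$ tiles. $\operatorname{Re}\sqrt{x}$ denotes the real part of the square root, so it equals $\sqrt{x}$ for $x\ge 0$ and $0$ for $x<0$. *)

theory Defs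
  imports "HOL-Analysis.Analysis"
begin

text \<open>
  Points of the plane are elements of \<^typ>\<open>real \<times> real\<close>, whose distance is the Euclidean one.
\<close>

definition tile :: "real \<Rightarrow> real \<Rightarrow> int \<Rightarrow> int \<Rightarrow> (real \<times> real) set" where
  "tile a b k m =
     {of_int k * a .. of_int (k + 1) * a} \<times> {of_int m * b .. of_int (m + 1) * b}"

definition tiles :: "real \<Rightarrow> real \<Rightarrow> (real \<times> real) set set" where
  "tiles a b = {tile a b k m | k m. True}"

definition visits :: "(real \<times> real) set \<Rightarrow> (real \<times> real) set \<Rightarrow> bool" where
  "visits S T \<longleftrightarrow> S \<inter> interior T \<noteq> {}"

definition num_visited :: "real \<Rightarrow> real \<Rightarrow> real \<times> real \<Rightarrow> real \<times> real \<Rightarrow> nat" where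
  "num_visited a b p q = card {T \<in> tiles a b. visits (closed_segment p q) T}"

definition tau :: "real \<Rightarrow> real \<Rightarrow> real \<Rightarrow> nat" where
  "tau a b l = Max {num_visited a b p q | p q. dist p q = l}"

definition lambda :: "real \<Rightarrow> real \<Rightarrow> nat \<Rightarrow> real" where
  "lambda a b t = Inf {dist p q | p q. p \<noteq> q \<and> num_visited a b p q \<ge> t}"

text \<open>
  The real function \<^const>\<open>sqrt\<close> is odd, so for a negative argument it is not the real part
  of the square root; hence the use of \<^const>\<open>csqrt\<close>.
\<close>

definition i_star :: "real \<Rightarrow> real \<Rightarrow> real \<Rightarrow> int" where
  "i_star a b l =
     \<lceil>3 / 2 + b / a * Re (csqrt (complex_of_real (l\<^sup>2 / (a\<^sup>2 + b\<^sup>2) - 1 / 4)))\<rceil>"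

definition j_star :: "real \<Rightarrow> real \<Rightarrow> real \<Rightarrow> int" where
  "j_star a b l = \<lceil>1 + sqrt (l\<^sup>2 - (of_int (i_star a b l) - 2)\<^sup>2 * a\<^sup>2) / b\<rceil>"

text \<open>
  Piecewise constant: there are breakpoints, finitely many in every bounded interval, such that
  the function is constant on each interval free of breakpoints.
\<close>

definition piecewise_constant_on :: "real set \<Rightarrow> (real \<Rightarrow> 'a) \<Rightarrow> bool" where
  "piecewise_constant_on S f \<longleftrightarrow>
     (\<exists>D. (\<forall>x y. finite (D \<inter> {x..y})) \<and>
          (\<forall>I. is_interval I \<and> I \<subseteq> S - D \<longrightarrow> f constant_on I))"

text \<open>A jump: both one-sided limits exist and differ; its (signed) height is their difference.\<close>

definition has_jump :: "(real \<Rightarrow> real) \<Rightarrow> real \<Rightarrow> real \<Rightarrow> bool" where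
  "has_jump f x h \<longleftrightarrow>
     (\<exists>L R. (f \<longlongrightarrow> L) (at_left x) \<and> (f \<longlongrightarrow> R) (at_right x) \<and> L \<noteq> R \<and> h = R - L)"

end

theory Submission imports Defs begin

text \<open>
  A segment with horizontal and vertical extents \<open>u\<close> and \<open>v\<close> in general position gains one tile
  at each crossing of a grid line, so \<open>\<tau>(\<ell>) = 3 + max (P + Q)\<close> over the \<open>P, Q \<in> \<nat>\<close> for which one
  can have \<open>u > P a\<close> and \<open>v > Q b\<close>, that is, over the \<open>P, Q\<close> with \<open>(P a)\<^sup>2 + (Q b)\<^sup>2 < \<ell>\<^sup>2\<close>. Hence
  \<open>\<tau>\<close> jumps from \<open>n + 2\<close> to \<open>n + 3\<close> just after the least value of \<open>sqrt ((P a)\<^sup>2 + (Q b)\<^sup>2)\<close> with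
  \<open>P + Q = n\<close>, which is \<open>\<lambda>(n + 3)\<close>. For the closed formula, let \<open>c\<close> be the abscissa of the midpoint
  of the chord with direction \<open>(a, - b)\<close> and length \<open>sqrt (a\<^sup>2 + b\<^sup>2)\<close> of the circle of radius
  \<open>\<ell>\<close> (\<open>c = 0\<close> if there is no such chord). Replacing \<open>(P, Q)\<close> by \<open>(P + 1, Q - 1)\<close> keeps the point \<open>(P a, Q b)\<close> in the open disc
  as long as \<open>(P + 1/2) a < c\<close>, and the reverse exchange does as long as
  \<open>(P + 1/2) a \<ge> c\<close> after it. So some maximiser has \<open>P\<close> equal to the least integer with
  \<open>(P + 1/2) a \<ge> c\<close>, which is \<open>i\<^sup>* - 2\<close>.
\<close>

section \<open>Visited tiles\<close>

lemma interior_tile: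
  "interior (tile a b k m) =
     {of_int k * a <..< of_int (k + 1) * a} \<times> {of_int m * b <..< of_int (m + 1) * b}"
  by (simp add: tile_def interior_Times)

lemma tile_inject:
  fixes a b :: real
  assumes "a > 0" "b > 0" and eq: "tile a b k m = tile a b k' m'"
  shows "k = k' \<and> m = m'"
proof -
  have corner: "(of_int k * a, of_int m * b) \<in> tile a b k m" for k m
    using assms(1,2) by (simp add: tile_def)
  have "(of_int k * a, of_int m * b) \<in> tile a b k' m'"
    "(of_int k' * a, of_int m' * b) \<in> tile a b k m"
    using corner[of k m] corner[of k' m'] eq by simp_all
  then show ?thesis
    using assms(1,2) by (auto simp: tile_def)
qed

lemma visits_segment_iff:
  "visits (closed_segment p q) (tile a b k m) \<longleftrightarrow>
    (\<exists>s\<in>{0..1}. of_int k * a < fst p + s * (fst q - fst p) \<and>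
                 fst p + s * (fst q - fst p) < (of_int k + 1) * a \<and>
                 of_int m * b < snd p + s * (snd q - snd p) \<and>
                 snd p + s * (snd q - snd p) < (of_int m + 1) * b)"
proof -
  have *: "(1 - s) * x + s * y = x + s * (y - x)" for s x y :: real
    by (simp add: algebra_simps)
  obtain x y x' y' where "p = (x, y)" "q = (x', y')" by (cases p; cases q)
  then have "closed_segment p q =
      (\<lambda>s. (fst p + s * (fst q - fst p), snd p + s * (snd q - snd p))) ` {0..1}"
    by (auto simp: closed_segment_def * image_iff)
  then show ?thesis
    by (auto simp: visits_def interior_tile disjoint_iff)
qed

section \<open>Integer sets of bounded spread and cells of a one-dimensional grid\<close>

lemma finite_int_spread:
  fixes S :: "int set"
  assumes "\<And>x y. x \<in> S \<Longrightarrow> y \<in> S \<Longrightarrow> y - x \<le> int n"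
  shows "finite S \<and> card S \<le> n + 1"
proof (cases "S = {}")
  case False
  then obtain c where c: "c \<in> S" by blast
  \<comment> \<open>Confinement around \<open>c\<close> only yields finiteness. That makes
    \<open>Min S\<close> available, and confinement above \<open>Min S\<close> then gives the sharp
    count.\<close>
  have "S \<subseteq> {c - int n .. c + int n}"
    using assms[OF c] assms[OF _ c] by fastforce
  then have fin: "finite S" by (rule finite_subset) simp
  have "S \<subseteq> {Min S .. Min S + int n}"
    using assms[OF Min_in[OF fin False]] fin by fastforce
  then have "card S \<le> card {Min S .. Min S + int n}"
    by (intro card_mono) auto
  with fin show ?thesis by simp
qed simp

text \<open>Two points in the interiors of columns \<open>k\<close> and \<open>k'\<close> have all
  the \<open>\<bar>k' - k\<bar> - 1\<close> columns in between separating them, and each point keeps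
  a positive distance from these columns.\<close>

lemma int_gap_less:
  fixes a x y d :: real
  assumes "a > 0" "of_int k * a < x" "x < (of_int k + 1) * a"
    "of_int k' * a < y" "y < (of_int k' + 1) * a" "\<bar>y - x\<bar> \<le> d" "\<bar>k' - k\<bar> \<ge> 2"
  shows "of_int (\<bar>k' - k\<bar> - 1) * a < d"
  using assms by (auto simp: abs_if algebra_simps split: if_splits)

lemma int_cell_mono:
  fixes a x y :: real
  assumes "a > 0" "of_int k * a < x" "y < (of_int k' + 1) * a" "x \<le> y"
  shows "k \<le> k'"
proof -
  have "of_int k * a < (of_int k' + 1) * a" using assms by linarith
  then have "of_int k < (of_int k' + 1 :: real)" using assms(1) by simp
  then show ?thesis by linarith
qed

locale grid =
  fixes a b :: real
  assumes a_pos: "a > 0" and b_pos: "b > 0"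
begin

definition feasible :: "real \<Rightarrow> nat \<Rightarrow> nat \<Rightarrow> bool" where
  "feasible l P Q \<longleftrightarrow> (real P * a)\<^sup>2 + (real Q * b)\<^sup>2 < l\<^sup>2"

definition index_set :: "real \<times> real \<Rightarrow> real \<times> real \<Rightarrow> (int \<times> int) set" where
  "index_set p q = {(k, m). visits (closed_segment p q) (tile a b k m)}"

lemma num_visited_eq: "num_visited a b p q = card (index_set p q)"
proof -
  have "{T \<in> tiles a b. visits (closed_segment p q) T} = (\<lambda>(k, m). tile a b k m) ` index_set p q"
    by (auto simp: tiles_def index_set_def)
  moreover have "inj_on (\<lambda>(k, m). tile a b k m) (index_set p q)"
    using tile_inject[OF a_pos b_pos] by (auto simp: inj_on_def)
  ultimately show ?thesis
    by (simp add: num_visited_def card_image)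
qed

text \<open>After a choice of signs both tile indices are nondecreasing along the segment, so their
  signed sum \<open>f\<close> separates the visited tiles, whose number is at most one more than the
  spread of \<open>f\<close>. Finiteness is stated too because \<open>card\<close> is 0 on infinite
  sets.\<close>

lemma index_set_upper:
  assumes l: "dist p q = l" "l > 0"
    and N: "\<And>P Q. feasible l P Q \<Longrightarrow> P + Q \<le> N"
  shows "finite (index_set p q) \<and> card (index_set p q) \<le> N + 3"
proof -
  define u v where "u = fst q - fst p" and "v = snd q - snd p"
  define \<sigma> \<rho> :: int where "\<sigma> = (if u \<ge> 0 then 1 else -1)" and "\<rho> = (if v \<ge> 0 then 1 else -1)"
  define f where "f = (\<lambda>(k, m). \<sigma> * k + \<rho> * m)"
  have uv: "u\<^sup>2 + v\<^sup>2 = l\<^sup>2"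
    using l by (cases p; cases q) (auto simp: u_def v_def dist_prod_def dist_real_def power2_commute)
  let ?at = "\<lambda>s k m. s \<in> {0..1} \<and> of_int k * a < fst p + s * u \<and> fst p + s * u < (of_int k + 1) * a \<and>
                 of_int m * b < snd p + s * v \<and> snd p + s * v < (of_int m + 1) * b"
  have index_set: "index_set p q = {(k, m). \<exists>s. ?at s k m}"
    by (auto simp: index_set_def visits_segment_iff u_def v_def)
  have mono: "\<sigma> * k \<le> \<sigma> * k' \<and> \<rho> * m \<le> \<rho> * m'"
    if "?at s k m" "?at s' k' m'" "s \<le> s'" for s s' k k' m m'
  proof
    show "\<sigma> * k \<le> \<sigma> * k'"
    proof (cases "u \<ge> 0")
      case True
      then have "s * u \<le> s' * u" using that(3) by (simp add: mult_right_mono)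
      then show ?thesis
        using int_cell_mono[OF a_pos, of k "fst p + s * u" "fst p + s' * u" k'] that True
        by (simp add: \<sigma>_def)
    next
      case False
      then have "s' * u \<le> s * u" using that(3) by (simp add: mult_right_mono_neg)
      then show ?thesis
        using int_cell_mono[OF a_pos, of k' "fst p + s' * u" "fst p + s * u" k] that False
        by (simp add: \<sigma>_def)
    qed
    show "\<rho> * m \<le> \<rho> * m'"
    proof (cases "v \<ge> 0")
      case True
      then have "s * v \<le> s' * v" using that(3) by (simp add: mult_right_mono)
      then show ?thesis
        using int_cell_mono[OF b_pos, of m "snd p + s * v" "snd p + s' * v" m'] that True
        by (simp add: \<rho>_def)
    next
      case False
      then have "s' * v \<le> s * v" using that(3) by (simp add: mult_right_mono_neg)
      then show ?thesis
        using int_cell_mono[OF b_pos, of m' "snd p + s' * v" "snd p + s * v" m] that False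
        by (simp add: \<rho>_def)
    qed
  qed
  have sign: "\<bar>\<sigma>\<bar> = 1" "\<bar>\<rho>\<bar> = 1" by (auto simp: \<sigma>_def \<rho>_def)
  \<comment> \<open>Visited tiles are comparable in both signed indices at once, so equal sums force
    both indices to agree.\<close>
  have eq: "k = k' \<and> m = m'"
    if "?at s k m" "?at s' k' m'" "f (k, m) = f (k', m')" for s s' k k' m m'
  proof -
    have "\<sigma> * k \<le> \<sigma> * k' \<and> \<rho> * m \<le> \<rho> * m' \<or> \<sigma> * k' \<le> \<sigma> * k \<and> \<rho> * m' \<le> \<rho> * m"
      using mono[OF that(1,2)] mono[OF that(2,1)] by linarith
    moreover have "\<sigma> * k + \<rho> * m = \<sigma> * k' + \<rho> * m'" using that(3) by (simp add: f_def)
    ultimately have "\<sigma> * k = \<sigma> * k' \<and> \<rho> * m = \<rho> * m'" by linarith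
    then show ?thesis using sign by fastforce
  qed
  have inj: "inj_on f (index_set p q)"
  proof (rule inj_onI, clarify)
    fix k m k' m'
    assume "(k, m) \<in> index_set p q" "(k', m') \<in> index_set p q" "f (k, m) = f (k', m')"
    then show "k = k' \<and> m = m'" unfolding index_set using eq by blast
  qed
  have dist_le: "\<bar>k' - k\<bar> + \<bar>m' - m\<bar> \<le> int (N + 2)"
    if at: "?at s k m" "?at s' k' m'" for s s' k k' m m'
  proof -
    have s: "\<bar>s' - s\<bar> \<le> 1" using at by auto
    have "\<bar>s' - s\<bar> * \<bar>u\<bar> \<le> \<bar>u\<bar>" "\<bar>s' - s\<bar> * \<bar>v\<bar> \<le> \<bar>v\<bar>"
      using s by (auto intro: mult_left_le_one_le)
    then have x: "\<bar>(fst p + s' * u) - (fst p + s * u)\<bar> \<le> \<bar>u\<bar>"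
      and y: "\<bar>(snd p + s' * v) - (snd p + s * v)\<bar> \<le> \<bar>v\<bar>"
      by (simp_all add: abs_mult[symmetric] algebra_simps)
    \<comment> \<open>These count the full columns and rows strictly between the two tiles, cut off
      at 0 for equal or adjacent ones. Always \<open>\<bar>k' - k\<bar> \<le> P + 1\<close> and
      likewise for \<open>Q\<close>, which accounts for the 2 in \<open>N + 2\<close>.\<close>
    define P Q where "P = nat (\<bar>k' - k\<bar> - 1)" and "Q = nat (\<bar>m' - m\<bar> - 1)"
    have P: "real P * a < \<bar>u\<bar>" if "P \<noteq> 0"
    proof -
      have "2 \<le> \<bar>k' - k\<bar>" "real P = of_int (\<bar>k' - k\<bar> - 1)" using that by (auto simp: P_def)
      then show ?thesis
        using int_gap_less[OF a_pos, of k "fst p + s * u" k' "fst p + s' * u" "\<bar>u\<bar>"] at x by simp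
    qed
    have Q: "real Q * b < \<bar>v\<bar>" if "Q \<noteq> 0"
    proof -
      have "2 \<le> \<bar>m' - m\<bar>" "real Q = of_int (\<bar>m' - m\<bar> - 1)" using that by (auto simp: Q_def)
      then show ?thesis
        using int_gap_less[OF b_pos, of m "snd p + s * v" m' "snd p + s' * v" "\<bar>v\<bar>"] at y by simp
    qed
    have P2: "P \<noteq> 0 \<Longrightarrow> (real P * a)\<^sup>2 < u\<^sup>2" and Q2: "Q \<noteq> 0 \<Longrightarrow> (real Q * b)\<^sup>2 < v\<^sup>2"
      using P Q a_pos b_pos power_strict_mono[of "real P * a" "\<bar>u\<bar>" 2]
        power_strict_mono[of "real Q * b" "\<bar>v\<bar>" 2] by simp_all
    have P3: "(real P * a)\<^sup>2 \<le> u\<^sup>2" by (cases "P = 0") (use P2 in auto)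
    have Q3: "(real Q * b)\<^sup>2 \<le> v\<^sup>2" by (cases "Q = 0") (use Q2 in auto)
    have "feasible l P Q"
      unfolding feasible_def uv[symmetric]
    \<comment> \<open>Strictness comes from any nonzero one of \<open>P\<close> and
      \<open>Q\<close>; if both vanish, it comes from \<open>l > 0\<close>.\<close>
    proof (cases "P = 0 \<and> Q = 0")
      case True
      then show "(real P * a)\<^sup>2 + (real Q * b)\<^sup>2 < u\<^sup>2 + v\<^sup>2" using uv l by simp
    next
      case False
      then show "(real P * a)\<^sup>2 + (real Q * b)\<^sup>2 < u\<^sup>2 + v\<^sup>2" using P2 Q2 P3 Q3 by linarith
    qed
    then have "P + Q \<le> N" by (rule N)
    then show ?thesis by (simp add: P_def Q_def)
  qed
  have "y - x \<le> int (N + 2)" if xy: "x \<in> f ` index_set p q" "y \<in> f ` index_set p q" for x y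
  proof -
    obtain z z' where z: "z \<in> index_set p q" "z' \<in> index_set p q" "x = f z" "y = f z'"
      using xy by blast
    obtain k m k' m' where "z = (k, m)" "z' = (k', m')" by (cases z; cases z')
    with z have km: "(k, m) \<in> index_set p q" "(k', m') \<in> index_set p q"
      "x = f (k, m)" "y = f (k', m')"
      by simp_all
    then obtain s s' where at: "?at s k m" "?at s' k' m'"
      unfolding index_set by blast
    have "y - x \<le> \<bar>k' - k\<bar> + \<bar>m' - m\<bar>"
      using km(3,4) by (auto simp: f_def \<sigma>_def \<rho>_def)
    with dist_le[OF at] show ?thesis by linarith
  qed
  from finite_int_spread[of "f ` index_set p q", OF this] inj show ?thesis
    by (simp add: finite_image_iff card_image numeral_3_eq_3)
qed

section \<open>A segment attaining the upper bound\<close>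

lemma floor_tile_visited:
  fixes x y u v s :: real
  assumes uv: "u > 0" "v > 0" and s: "0 \<le> s" "s < 1"
  shows "(\<lfloor>(x + s * u) / a\<rfloor>, \<lfloor>(y + s * v) / b\<rfloor>) \<in> index_set (x, y) (x + u, y + v)"
proof -
  define k m where "k = \<lfloor>(x + s * u) / a\<rfloor>" and "m = \<lfloor>(y + s * v) / b\<rfloor>"
  have k: "of_int k * a \<le> x + s * u" "x + s * u < (of_int k + 1) * a"
    using a_pos by (simp_all add: k_def floor_divide_lower floor_divide_upper)
  have m: "of_int m * b \<le> y + s * v" "y + s * v < (of_int m + 1) * b"
    using b_pos by (simp_all add: m_def floor_divide_lower floor_divide_upper)
  \<comment> \<open>Moving on by less than \<open>e\<close> stays on the segment and leaves neither
    the column nor the row. Since both coordinates strictly increase, the point at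
    \<open>s + e / 2\<close> is off the lower and left edges, hence interior.\<close>
  define e where "e = Min {1 - s, ((of_int k + 1) * a - (x + s * u)) / u,
                           ((of_int m + 1) * b - (y + s * v)) / v}"
  have "e > 0" using k m uv s by (simp add: e_def)
  moreover have "e \<le> 1 - s" "e \<le> ((of_int k + 1) * a - (x + s * u)) / u"
    "e \<le> ((of_int m + 1) * b - (y + s * v)) / v"
    by (simp_all add: e_def)
  ultimately have e: "e > 0" "e \<le> 1 - s" "e * u \<le> (of_int k + 1) * a - (x + s * u)"
    "e * v \<le> (of_int m + 1) * b - (y + s * v)"
    using uv by (simp_all add: pos_le_divide_eq)
  moreover have "e * u > 0" "e * v > 0" using e(1) uv by simp_all
  ultimately show ?thesis
    unfolding k_def[symmetric] m_def[symmetric] index_set_def visits_segment_iff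
    using k m s by (auto intro!: bexI[of _ "s + e / 2"] simp: distrib_right)
qed

text \<open>The segment starts in tile (0, 0) and crosses \<open>P + 1\<close> vertical and
  \<open>Q + 1\<close> horizontal lines at distinct moments, entering a new tile each time. The
  count is conditional on finiteness, which \<open>index_set_upper\<close> supplies later.\<close>

lemma exists_segment:
  assumes "feasible l P Q" and l: "l > 0"
  obtains p q where "dist p q = l" and "finite (index_set p q) \<Longrightarrow> card (index_set p q) \<ge> P + Q + 3"
proof -
  \<comment> \<open>The surplus of the squared length is split evenly, so that both extents strictly
    exceed \<open>P a\<close> and \<open>Q b\<close>.\<close>
  define d where "d = (l\<^sup>2 - (real P * a)\<^sup>2 - (real Q * b)\<^sup>2) / 2"
  have d: "d > 0" using assms by (simp add: d_def feasible_def)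
  define u v where "u = sqrt ((real P * a)\<^sup>2 + d)" and "v = sqrt ((real Q * b)\<^sup>2 + d)"
  have u: "u > real P * a" and v: "v > real Q * b"
    unfolding u_def v_def using d by (auto intro!: real_less_rsqrt)
  have uv0: "u > 0" "v > 0" unfolding u_def v_def using d
    by (auto intro: add_nonneg_pos)
  have uv: "sqrt (u\<^sup>2 + v\<^sup>2) = l" using d l by (simp add: u_def v_def d_def add_nonneg_nonneg)
  \<comment> \<open>The start lies in column 0, yet far enough right for the end to pass the line
    with index \<open>P + 1\<close>.\<close>
  obtain x where x: "max 0 (real (P + 1) * a - u) < x" "x < a"
    using dense[of "max 0 (real (P + 1) * a - u)" a] u a_pos by (auto simp: algebra_simps)
  \<comment> \<open>For these finitely many ordinates the line of the segment would pass through a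
    grid point, merging two crossings into one; an interval of admissible ordinates remains to
    choose from.\<close>
  define bad where
    "bad = (\<lambda>(k, m). real m * b - v * ((real k * a - x) / u)) ` ({1..P+1} \<times> {1..Q+1})"
  have "infinite {max 0 (real (Q + 1) * b - v) <..< b}"
    using v b_pos by (auto simp: infinite_Ioo_iff algebra_simps)
  moreover have "finite bad" by (simp add: bad_def)
  ultimately have "{max 0 (real (Q + 1) * b - v) <..< b} - bad \<noteq> {}"
    by (metis Diff_eq_empty_iff finite_subset)
  then obtain y where "y \<in> {max 0 (real (Q + 1) * b - v) <..< b} - bad" by blast
  then have y: "max 0 (real (Q + 1) * b - v) < y" "y < b" "y \<notin> bad"
    unfolding Diff_iff greaterThanLessThan_iff by blast+
  define t where "t = (\<lambda>k::nat. (real k * a - x) / u)"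
  define r where "r = (\<lambda>m::nat. (real m * b - y) / v)"
  have t01: "0 < t k \<and> t k < 1" if "k \<in> {1..P+1}" for k
  proof -
    have "real k * a \<le> real (P + 1) * a" "1 * a \<le> real k * a"
      using that a_pos by (auto intro!: mult_right_mono simp del: of_nat_add)
    then have "0 < real k * a - x" "real k * a - x < u" using x by linarith+
    then show ?thesis using uv0 by (simp add: t_def)
  qed
  have r01: "0 < r m \<and> r m < 1" if "m \<in> {1..Q+1}" for m
  proof -
    have "real m * b \<le> real (Q + 1) * b" "1 * b \<le> real m * b"
      using that b_pos by (auto intro!: mult_right_mono simp del: of_nat_add)
    then have "0 < real m * b - y" "real m * b - y < v" using y by linarith+
    then show ?thesis using uv0 by (simp add: r_def)
  qed
  have injt: "inj_on t {1..P+1}" and injr: "inj_on r {1..Q+1}"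
    using a_pos b_pos uv0 by (auto simp: inj_on_def t_def r_def)
  have neq: "t k \<noteq> r m" if "k \<in> {1..P+1}" "m \<in> {1..Q+1}" for k m
  proof
    assume "t k = r m"
    then have "y = real m * b - v * ((real k * a - x) / u)"
      using uv0 by (simp add: t_def r_def field_simps)
    then have "y \<in> bad" unfolding bad_def using that by (intro image_eqI[of _ _ "(k, m)"]) auto
    with y(3) show False by simp
  qed
  define C where "C = insert 0 (t ` {1..P+1} \<union> r ` {1..Q+1})"
  have "card (t ` {1..P+1} \<union> r ` {1..Q+1}) = (P + 1) + (Q + 1)"
    using injt injr neq by (subst card_Un_disjoint) (auto simp: card_image)
  moreover have "0 \<notin> t ` {1..P+1} \<union> r ` {1..Q+1}" using t01 r01 by force
  ultimately have cardC: "card C = P + Q + 3" by (simp add: C_def)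
  have C_cases: "s = 0 \<or> (\<exists>k\<in>{1..P+1}. s = t k) \<or> (\<exists>m\<in>{1..Q+1}. s = r m)" if "s \<in> C" for s
    using that unfolding C_def by blast
  have C01: "0 \<le> s \<and> s < 1" if "s \<in> C" for s
    using C_cases[OF that] t01 r01 by (metis less_eq_real_def zero_less_one)
  define h where "h = (\<lambda>s. (\<lfloor>(x + s * u) / a\<rfloor>, \<lfloor>(y + s * v) / b\<rfloor>))"
  \<comment> \<open>At the later parameter the point lies exactly on a grid line that the earlier
    point has not reached, so the corresponding floor has increased.\<close>
  have neq_h: "h s \<noteq> h s'" if ss: "s \<in> C" "s' \<in> C" "s < s'" for s s'
  proof -
    have "s' \<noteq> 0" using C01[OF ss(1)] ss(3) by simp
    then consider k where "s' = t k" | m where "s' = r m" using C_cases[OF ss(2)] by blast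
    then show ?thesis
    proof cases
      case (1 k)
      have "x + s' * u = real k * a" using uv0 by (simp add: 1 t_def)
      moreover have "s * u < s' * u" using ss(3) uv0 by simp
      ultimately have "(x + s * u) / a < real k" "(x + s' * u) / a = real k"
        using a_pos by (auto simp: field_simps)
      then have "\<lfloor>(x + s * u) / a\<rfloor> < int k" "\<lfloor>(x + s' * u) / a\<rfloor> = int k"
        by (auto simp: floor_less_iff)
      then show ?thesis by (simp add: h_def)
    next
      case (2 m)
      have "y + s' * v = real m * b" using uv0 by (simp add: 2 r_def)
      moreover have "s * v < s' * v" using ss(3) uv0 by simp
      ultimately have "(y + s * v) / b < real m" "(y + s' * v) / b = real m"
        using b_pos by (auto simp: field_simps)
      then have "\<lfloor>(y + s * v) / b\<rfloor> < int m" "\<lfloor>(y + s' * v) / b\<rfloor> = int m"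
        by (auto simp: floor_less_iff)
      then show ?thesis by (simp add: h_def)
    qed
  qed
  have injh: "inj_on h C"
    by (rule linorder_inj_onI) (use neq_h in auto)
  have sub: "h ` C \<subseteq> index_set (x, y) (x + u, y + v)"
    using floor_tile_visited[OF uv0] C01 by (auto simp: h_def)
  show thesis
  proof (rule that)
    show "dist (x, y) (x + u, y + v) = l"
      using uv by (simp add: dist_prod_def dist_real_def)
    show "card (index_set (x, y) (x + u, y + v)) \<ge> P + Q + 3"
      if "finite (index_set (x, y) (x + u, y + v))"
      using card_mono[OF that sub] card_image[OF injh] cardC by simp
  qed
qed

section \<open>The maximum as a lattice point problem\<close>

text \<open>The upper bound and the constructed segment meet. The bound also makes the set of counts
  finite, so that \<open>Max\<close> is meaningful.\<close>

lemma tau_max: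
  assumes l: "l > 0" and f: "feasible l P Q"
    and N: "\<And>P' Q'. feasible l P' Q' \<Longrightarrow> P' + Q' \<le> P + Q"
  shows "tau a b l = P + Q + 3" and "\<exists>p q. dist p q = l \<and> num_visited a b p q = tau a b l"
    and "\<And>p q. dist p q = l \<Longrightarrow> num_visited a b p q \<le> tau a b l"
proof -
  note upper = index_set_upper[OF _ l, of _ _ "P + Q"]
  have le: "num_visited a b p q \<le> P + Q + 3" if "dist p q = l" for p q
    using upper[OF that N] by (simp add: num_visited_eq)
  obtain p q where pq: "dist p q = l"
    "finite (index_set p q) \<Longrightarrow> card (index_set p q) \<ge> P + Q + 3"
    using exists_segment[OF f l] by blast
  have eq: "num_visited a b p q = P + Q + 3"
    using upper[OF pq(1) N] pq(2) by (auto simp: num_visited_eq intro: antisym)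
  show tau: "tau a b l = P + Q + 3"
    unfolding tau_def
  proof (rule Max_eqI)
    show "finite {num_visited a b p q |p q. dist p q = l}"
      by (rule finite_subset[of _ "{..P + Q + 3}"]) (use le in auto)
    show "P + Q + 3 \<in> {num_visited a b p q |p q. dist p q = l}"
      using pq(1) eq[symmetric] by blast
  qed (use le in auto)
  show "\<exists>p q. dist p q = l \<and> num_visited a b p q = tau a b l"
    using pq(1) eq tau by metis
  show "num_visited a b p q \<le> tau a b l" if "dist p q = l" for p q
    using le[OF that] tau by simp
qed

lemma ex_max_feasible:
  assumes "l > 0"
  obtains P Q where "feasible l P Q" "\<And>P' Q'. feasible l P' Q' \<Longrightarrow> P' + Q' \<le> P + Q"
proof -
  have bound: "P + Q \<le> nat \<lceil>l / a\<rceil> + nat \<lceil>l / b\<rceil>" if "feasible l P Q" for P Q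
  proof -
    have *: "(real P * a)\<^sup>2 < l\<^sup>2" "(real Q * b)\<^sup>2 < l\<^sup>2"
      using that zero_le_power2[of "real P * a"] zero_le_power2[of "real Q * b"]
      unfolding feasible_def by linarith+
    have "real P * a < l" "real Q * b < l"
      using power2_less_imp_less[OF *(1)] power2_less_imp_less[OF *(2)] assms by auto
    then have "real P \<le> l / a" "real Q \<le> l / b" using a_pos b_pos by (auto simp: field_simps)
    then show ?thesis by linarith
  qed
  have "feasible l 0 0" using assms by (simp add: feasible_def)
  then have "\<exists>z. case_prod (feasible l) z \<and>
      (\<forall>z'. case_prod (feasible l) z' \<longrightarrow> fst z' + snd z' \<le> fst z + snd z)"
    by (intro ex_has_greatest_nat[of _ "(0, 0)" _ "Suc (nat \<lceil>l / a\<rceil> + nat \<lceil>l / b\<rceil>)"])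
       (auto simp: less_Suc_eq_le dest: bound)
  then show thesis using that by auto
qed

section \<open>Threshold lengths, their monotonicity, and \<open>lambda\<close>\<close>

definition thr :: "nat \<Rightarrow> real" where
  "thr n = Min ((\<lambda>P. sqrt ((real P * a)\<^sup>2 + (real (n - P) * b)\<^sup>2)) ` {..n})"

text \<open>A minimum over a finite set is attained, so the strict inequality passes to one of its
  members. This strictness is the source of left-continuity.\<close>

lemma thr_less_iff:
  assumes "l > 0"
  shows "thr n < l \<longleftrightarrow> (\<exists>P Q. P + Q = n \<and> feasible l P Q)"
proof -
  have "sqrt z < l \<longleftrightarrow> z < l\<^sup>2" for z
    using assms real_sqrt_less_iff[of z "l\<^sup>2"] by simp
  then have "thr n < l \<longleftrightarrow> (\<exists>P\<le>n. feasible l P (n - P))"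
    unfolding thr_def feasible_def by (subst Min_less_iff) auto
  also have "\<dots> \<longleftrightarrow> (\<exists>P Q. P + Q = n \<and> feasible l P Q)"
    by (metis add_diff_cancel_left' le_add1 le_add_diff_inverse)
  finally show ?thesis .
qed

lemma thr_0: "thr 0 = 0"
  by (simp add: thr_def)

text \<open>Lowering one positive coordinate of a lattice point on antidiagonal \<open>n + 1\<close>
  gives a point on antidiagonal \<open>n\<close> strictly closer to the origin.\<close>

lemma thr_strict_mono: "strict_mono thr"
  unfolding strict_mono_Suc_iff
proof
  fix n
  have less: "real P * c < real (Suc P) * c" if "c > 0" for P and c :: real
    using that by (simp add: distrib_right)
  have sq: "(real P * c)\<^sup>2 < (real (Suc P) * c)\<^sup>2" if "c > 0" for P and c :: real
    using less[OF that] that by (intro power_strict_mono) auto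
  have "thr n < sqrt ((real P * a)\<^sup>2 + (real (Suc n - P) * b)\<^sup>2)" if "P \<le> Suc n" for P
  proof -
    \<comment> \<open>Truncated subtraction covers both moves: \<open>P\<close> is lowered if
      positive, and for \<open>P = 0\<close> the other coordinate drops from \<open>n + 1\<close> to
      \<open>n\<close>.\<close>
    have "thr n \<le> sqrt ((real (P - 1) * a)\<^sup>2 + (real (n - (P - 1)) * b)\<^sup>2)"
      unfolding thr_def using that by (intro Min_le) auto
    also have "\<dots> < sqrt ((real P * a)\<^sup>2 + (real (Suc n - P) * b)\<^sup>2)"
    proof (cases P)
      case 0
      with sq[OF b_pos, of n] show ?thesis by (intro real_sqrt_less_mono) (simp del: of_nat_Suc)
    next
      case (Suc P')
      with sq[OF a_pos, of P'] show ?thesis by (intro real_sqrt_less_mono) (simp del: of_nat_Suc)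
    qed
    finally show ?thesis .
  qed
  then show "thr n < thr (Suc n)"
    unfolding thr_def[of "Suc n"] by (subst Min_gr_iff) auto
qed

lemma thr_nonneg: "thr n \<ge> 0"
  using strict_mono_less_eq[OF thr_strict_mono, of 0 n] thr_0 by simp

text \<open>Since \<open>thr\<close> increases, the thresholds below \<open>l\<close> form an
  initial segment ending at the maximal feasible sum. All statements about limits and jumps rest on
  this equivalence.\<close>

lemma tau_ge_iff:
  assumes "l > 0"
  shows "n + 3 \<le> tau a b l \<longleftrightarrow> thr n < l"
proof -
  obtain P Q where PQ: "feasible l P Q" "\<And>P' Q'. feasible l P' Q' \<Longrightarrow> P' + Q' \<le> P + Q"
    using ex_max_feasible[OF assms] by blast
  have tau: "tau a b l = P + Q + 3" by (rule tau_max(1)[OF assms PQ])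
  have "thr (P + Q) < l" using thr_less_iff[OF assms] PQ(1) by blast
  moreover have "n \<le> P + Q \<longleftrightarrow> thr n \<le> thr (P + Q)"
    using strict_mono_less_eq[OF thr_strict_mono] by simp
  moreover have "n \<le> P + Q" if less: "thr n < l"
  proof -
    obtain P' Q' where "P' + Q' = n" "feasible l P' Q'"
      using less thr_less_iff[OF assms, of n] by blast
    then show ?thesis using PQ(2) by blast
  qed
  ultimately show ?thesis unfolding tau by force
qed

lemma tau_ge_3:
  assumes "l > 0"
  shows "3 \<le> tau a b l"
  using tau_ge_iff[OF assms, of 0] assms thr_0 by simp

lemma tau_eq_iff:
  assumes "l > 0"
  shows "tau a b l = n + 3 \<longleftrightarrow> thr n < l \<and> l \<le> thr (Suc n)"
  using tau_ge_iff[OF assms, of n] tau_ge_iff[OF assms, of "Suc n"] by auto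

text \<open>The admissible lengths form the open ray above \<open>thr n\<close>, whose infimum is
  its endpoint.\<close>

lemma lambda_eq: "lambda a b (n + 3) = thr n"
proof -
  have "{dist p q |p q. p \<noteq> q \<and> num_visited a b p q \<ge> n + 3} = {thr n <..}"
  proof (intro equalityI subsetI)
    fix l assume "l \<in> {dist p q |p q. p \<noteq> q \<and> num_visited a b p q \<ge> n + 3}"
    then obtain p q where pq: "l = dist p q" "p \<noteq> q" "num_visited a b p q \<ge> n + 3" by blast
    then have l: "l > 0" by simp
    obtain P Q where "feasible l P Q" "\<And>P' Q'. feasible l P' Q' \<Longrightarrow> P' + Q' \<le> P + Q"
      using ex_max_feasible[OF l] by blast
    then have "num_visited a b p q \<le> tau a b l" by (rule tau_max(3)[OF l]) (simp_all add: pq)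
    then show "l \<in> {thr n <..}" using pq(3) tau_ge_iff[OF l, of n] by simp
  next
    fix l assume *: "l \<in> {thr n <..}"
    then have l: "l > 0" using thr_nonneg[of n] by simp
    obtain P Q where "feasible l P Q" "\<And>P' Q'. feasible l P' Q' \<Longrightarrow> P' + Q' \<le> P + Q"
      using ex_max_feasible[OF l] by blast
    then obtain p q where pq: "dist p q = l" "num_visited a b p q = tau a b l"
      using tau_max(2)[OF l] by blast
    have "p \<noteq> q" using pq(1) l by auto
    moreover have "num_visited a b p q \<ge> n + 3" using * pq(2) tau_ge_iff[OF l, of n] by simp
    ultimately show "l \<in> {dist p q |p q. p \<noteq> q \<and> num_visited a b p q \<ge> n + 3}"
      using pq(1) by blast
  qed
  then show ?thesis by (simp add: lambda_def)
qed

section \<open>The closed formula\<close>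

lemma tau_formula:
  assumes l: "l > 0" and ab: "a \<ge> b"
  shows "int (tau a b l) = i_star a b l + j_star a b l - 1"
proof -
  define D where "D = a\<^sup>2 + b\<^sup>2"
  define \<sigma> where "\<sigma> = l\<^sup>2 / D - 1 / 4"
  define s where "s = Re (csqrt (complex_of_real \<sigma>))"
  have D: "D > 0" using a_pos by (simp add: D_def add_pos_nonneg)
  have l2: "l\<^sup>2 = D * (\<sigma> + 1 / 4)" using D by (simp add: \<sigma>_def)
  have s0: "s \<ge> 0" by (simp add: s_def)
  \<comment> \<open>The midpoint of the chord is \<open>(b * s, a * s)\<close>. If \<sigma> is
    negative there is no chord and \<open>s\<close> is 0, so the equation needs \<open>s > 0\<close>
    while the inequality always holds.\<close>
  have s2: "\<sigma> \<le> s\<^sup>2" "s > 0 \<Longrightarrow> s\<^sup>2 = \<sigma>"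
    by (cases "\<sigma> \<ge> 0"; simp add: s_def)+
  define p where "p = i_star a b l - 2"
  have p: "p = \<lceil>b / a * s - 1 / 2\<rceil>"
    unfolding p_def i_star_def s_def \<sigma>_def D_def by linarith
  have "b / a * s \<ge> 0" using a_pos b_pos s0 by simp
  then have p0: "p \<ge> 0" unfolding p by linarith
  define P where "P = nat p"
  have Pp: "real P = of_int p" using p0 by (simp add: P_def)
  have "b / a * s - 1 / 2 \<le> real P'" if "P \<le> P'" for P'
    using that unfolding P_def p by linarith
  then have right: "b * s \<le> (real P' + 1 / 2) * a" if "P \<le> P'" for P'
    using that a_pos by (fastforce simp: field_simps)
  have "real P' < b / a * s - 1 / 2" if "P' < P" for P'
    using that unfolding P_def p by linarith
  then have left: "(real P' + 1 / 2) * a < b * s" if "P' < P" for P'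
    using that a_pos by (fastforce simp: field_simps)
  \<comment> \<open>\<open>(b \<xi>, Y)\<close> is the midpoint of a point \<open>(P' a, Q' b)\<close> and the one it is exchanged for\<close>
  have key: "(Y - a * \<xi>) * (Y + a * \<xi> - b) = (b * \<xi>)\<^sup>2 + Y\<^sup>2 + b * \<xi> * a - Y * b - D * \<xi>\<^sup>2" for Y \<xi>
    by (simp add: D_def power2_eq_square algebra_simps)
  \<comment> \<open>This is where \<open>a \<ge> b\<close> enters: together with
    \<open>b / 2 \<le> Y\<close> it makes the second factor in \<open>key\<close> nonnegative. The
    product in \<open>key\<close> is the squared norm of
    \<open>(b * \<xi> + a / 2, Y - b / 2)\<close> minus
    \<open>D * (\<xi>\<^sup>2 + 1 / 4)\<close>.\<close>
  have \<xi>: "\<exists>\<xi>. (real P' + 1 / 2) * a = b * \<xi> \<and> b / 2 \<le> a * \<xi>" for P'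
  proof (intro exI conjI)
    show "(real P' + 1 / 2) * a = b * ((real P' + 1 / 2) * a / b)" using b_pos by simp
    have "b * b \<le> a * a" using ab b_pos by (intro mult_mono) auto
    moreover have "1 / 2 * (a * a) \<le> (real P' + 1 / 2) * (a * a)"
      by (intro mult_right_mono) auto
    ultimately show "b / 2 \<le> a * ((real P' + 1 / 2) * a / b)"
      using b_pos by (simp add: field_simps)
  qed
  \<comment> \<open>Needed when an exchange starts at \<open>Q' = 0\<close>, and to make the
    radicand in \<open>j_star\<close> positive. The computation is \<open>key\<close> at
    \<open>Y = b / 2\<close>.\<close>
  have P_feasible: "real P * a < l"
  proof (cases P)
    case 0
    then show ?thesis using l by simp
  next
    case (Suc P')
    obtain \<xi> where X: "(real P' + 1 / 2) * a = b * \<xi>" "b / 2 \<le> a * \<xi>" using \<xi> by blast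
    have "\<xi> < s" using left[of P'] Suc X(1) b_pos by simp
    moreover have "0 < a * \<xi>" using X(2) b_pos by linarith
    then have "\<xi> > 0" using a_pos zero_less_mult_pos by blast
    ultimately have sx: "\<xi>\<^sup>2 < \<sigma>" using s2(2) power_strict_mono[of \<xi> s 2] by simp
    have "real P * a = b * \<xi> + a / 2" using X(1) Suc by (simp add: algebra_simps)
    then have "(real P * a)\<^sup>2 = (b * \<xi> + a / 2)\<^sup>2" by simp
    also have "\<dots> = D * (\<xi>\<^sup>2 + 1 / 4) - (a * \<xi> - b / 2)\<^sup>2"
      by (simp add: D_def power2_eq_square field_simps)
    also have "\<dots> \<le> D * (\<xi>\<^sup>2 + 1 / 4)" by simp
    also have "\<dots> < l\<^sup>2" unfolding l2 using sx D by simp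
    finally show ?thesis using l power2_less_imp_less by fastforce
  qed
  have up: "feasible l (Suc P') (Q' - 1)" if f: "feasible l P' Q'" and "P' < P" for P' Q'
  proof (cases Q')
    case 0
    have "real (Suc P') * a \<le> real P * a" using that a_pos by (intro mult_right_mono) auto
    then have "real (Suc P') * a < l" using P_feasible by linarith
    then have "(real (Suc P') * a)\<^sup>2 < l\<^sup>2" using a_pos by (intro power_strict_mono) auto
    then show ?thesis by (simp add: feasible_def 0)
  next
    case (Suc Q)
    obtain \<xi> where X: "(real P' + 1 / 2) * a = b * \<xi>" "b / 2 \<le> a * \<xi>" using \<xi> by blast
    have "\<xi> < s" using left[OF that(2)] X(1) b_pos by simp
    moreover have "0 < a * \<xi>" using X(2) b_pos by linarith
    then have "\<xi> > 0" using a_pos zero_less_mult_pos by blast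
    ultimately have sx: "D * \<xi>\<^sup>2 < D * \<sigma>" using D s2(2) power_strict_mono[of \<xi> s 2] by simp
    define Y where "Y = (real Q + 1 / 2) * b"
    have Y: "b / 2 \<le> Y" using b_pos by (simp add: Y_def algebra_simps)
    have "real P' * a = b * \<xi> - a / 2" "real Q' * b = Y + b / 2"
      "real (Suc P') * a = b * \<xi> + a / 2" "real (Q' - 1) * b = Y - b / 2"
      using X(1) by (simp_all add: Suc Y_def algebra_simps)
    then have in1: "(b * \<xi> - a / 2)\<^sup>2 + (Y + b / 2)\<^sup>2 < l\<^sup>2"
      and goal: "feasible l (Suc P') (Q' - 1) \<longleftrightarrow> (b * \<xi> + a / 2)\<^sup>2 + (Y - b / 2)\<^sup>2 < l\<^sup>2"
      using f by (simp_all only: feasible_def)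
    \<comment> \<open>Below the line through the origin with direction \<open>(b, a)\<close>, the
      sign of the product in \<open>key\<close> bounds the new point; on or above it, the exchange
      does not increase the norm.\<close>
    show ?thesis
    proof (cases "Y < a * \<xi>")
      case True
      then have "(Y - a * \<xi>) * (Y + a * \<xi> - b) \<le> 0"
        using Y X(2) by (intro mult_nonpos_nonneg) auto
      then have "(b * \<xi>)\<^sup>2 + Y\<^sup>2 + b * \<xi> * a - Y * b < D * \<sigma>"
        using key[of Y \<xi>] sx by linarith
      then show ?thesis unfolding goal l2
        by (simp add: D_def power2_eq_square algebra_simps)
    next
      case False
      then have "b * (a * \<xi>) \<le> b * Y" using b_pos by simp
      then have "(b * \<xi> + a / 2)\<^sup>2 + (Y - b / 2)\<^sup>2 \<le> (b * \<xi> - a / 2)\<^sup>2 + (Y + b / 2)\<^sup>2"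
        by (simp add: power2_eq_square algebra_simps)
      then show ?thesis unfolding goal using in1 by linarith
    qed
  qed
  have down: "feasible l P' (Suc Q')" if f: "feasible l (Suc P') Q'" and "P \<le> P'" for P' Q'
  proof -
    obtain \<xi> where X: "(real P' + 1 / 2) * a = b * \<xi>" "b / 2 \<le> a * \<xi>" using \<xi> by blast
    have "s \<le> \<xi>" using right[OF that(2)] X(1) b_pos by simp
    then have "\<sigma> \<le> \<xi>\<^sup>2" using s0 s2(1) power_mono[of s \<xi> 2] by linarith
    then have sx: "D * \<sigma> \<le> D * \<xi>\<^sup>2" using D by simp
    define Y where "Y = (real Q' + 1 / 2) * b"
    have Y: "b / 2 \<le> Y" using b_pos by (simp add: Y_def algebra_simps)
    have "real P' * a = b * \<xi> - a / 2" "real (Suc Q') * b = Y + b / 2"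
      "real (Suc P') * a = b * \<xi> + a / 2" "real Q' * b = Y - b / 2"
      using X(1) by (simp_all add: Y_def algebra_simps)
    then have in1: "(b * \<xi> + a / 2)\<^sup>2 + (Y - b / 2)\<^sup>2 < l\<^sup>2"
      and goal: "feasible l P' (Suc Q') \<longleftrightarrow> (b * \<xi> - a / 2)\<^sup>2 + (Y + b / 2)\<^sup>2 < l\<^sup>2"
      using f by (simp_all only: feasible_def)
    \<comment> \<open>Now the right-hand point is known to be in the disc and \<xi> is at least
      \<open>s\<close>, so the product in \<open>key\<close> is negative. This puts the midpoint
      below the line, where moving left brings the point closer to the origin.\<close>
    have "(b * \<xi>)\<^sup>2 + Y\<^sup>2 + b * \<xi> * a - Y * b < D * \<sigma>"
      using in1 unfolding l2 by (simp add: D_def power2_eq_square algebra_simps)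
    then have "(Y - a * \<xi>) * (Y + a * \<xi> - b) < 0" using key[of Y \<xi>] sx by linarith
    then have "Y < a * \<xi>" using Y X(2) by (auto simp: mult_less_0_iff)
    then have "b * Y \<le> b * (a * \<xi>)" using b_pos by simp
    then have "(b * \<xi> - a / 2)\<^sup>2 + (Y + b / 2)\<^sup>2 \<le> (b * \<xi> + a / 2)\<^sup>2 + (Y - b / 2)\<^sup>2"
      by (simp add: power2_eq_square algebra_simps)
    then show ?thesis unfolding goal using in1 by linarith
  qed
  have move_up: "\<exists>R. feasible l P R \<and> P' + Q' \<le> P + R" if "P' \<le> P" "feasible l P' Q'" for P' Q'
    using that
  proof (induction P' arbitrary: Q' rule: inc_induct)
    case (step P')
    from step.IH[OF up[OF step.prems step.hyps(2)]] show ?case by fastforce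
  qed auto
  have move_down: "\<exists>R. feasible l P R \<and> P' + Q' \<le> P + R" if "P \<le> P'" "feasible l P' Q'" for P' Q'
    using that
  proof (induction P' arbitrary: Q' rule: dec_induct)
    case (step P')
    from step.IH[OF down[OF step.prems step.hyps(1)]] show ?case by fastforce
  qed auto
  define g where "g = sqrt (l\<^sup>2 - (real P * a)\<^sup>2) / b"
  have "(real P * a)\<^sup>2 < l\<^sup>2" using P_feasible a_pos by (intro power_strict_mono) auto
  then have g0: "g > 0" and g2: "(g * b)\<^sup>2 = l\<^sup>2 - (real P * a)\<^sup>2"
    using b_pos by (simp_all add: g_def)
  have feas: "feasible l P R \<longleftrightarrow> real R < g" for R
  proof -
    have "feasible l P R \<longleftrightarrow> (real R * b)\<^sup>2 < (g * b)\<^sup>2" unfolding feasible_def g2 by auto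
    also have "\<dots> \<longleftrightarrow> real R * b < g * b"
      using b_pos g0
        power_strict_mono[of "real R * b" "g * b" 2] power_less_imp_less_base[of "real R * b" 2 "g * b"]
      by auto
    finally show ?thesis using b_pos by simp
  qed
  \<comment> \<open>The largest integer strictly below \<open>g\<close>. Hence \<open>j_star\<close>
    is \<open>Q + 2\<close>, and with \<open>i_star\<close> equal to \<open>P + 2\<close> the total
    \<open>P + Q + 3\<close> is \<open>i_star + j_star - 1\<close>.\<close>
  define Q where "Q = nat (\<lceil>g\<rceil> - 1)"
  have Q: "feasible l P Q" unfolding feas Q_def using g0 by linarith
  have QR: "R \<le> Q" if "feasible l P R" for R using that unfolding feas Q_def by linarith
  have "P' + Q' \<le> P + Q" if "feasible l P' Q'" for P' Q'
    using move_up[OF _ that] move_down[OF _ that] QR by (cases "P' \<le> P") fastforce+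
  from tau_max(1)[OF l Q this] have "tau a b l = P + Q + 3" .
  moreover have "j_star a b l = int Q + 2"
  proof -
    have "of_int (i_star a b l) - 2 = real P" using Pp by (simp add: p_def)
    then have "j_star a b l = \<lceil>1 + g\<rceil>" by (simp add: j_star_def g_def power_mult_distrib)
    then show ?thesis unfolding Q_def using g0 by linarith
  qed
  ultimately show ?thesis using p0 by (simp add: P_def p_def)
qed

section \<open>Continuity and jumps\<close>

lemma tau_at_left:
  assumes "l > 0"
  shows "eventually (\<lambda>x. tau a b x = tau a b l) (at_left l)"
proof -
  obtain n where n: "tau a b l = n + 3" using tau_ge_3[OF assms] nat_le_iff_add by (metis add.commute)
  then have "thr n < l" "l \<le> thr (Suc n)" using tau_eq_iff[OF assms] by auto
  then have "tau a b x = n + 3" if "x \<in> {thr n <..< l}" for x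
    using that thr_nonneg[of n] by (subst tau_eq_iff) auto
  with \<open>thr n < l\<close> n show ?thesis
    using eventually_at_left_real[of "thr n" l] by (auto elim: eventually_mono)
qed

lemma tau_at_right:
  assumes "l \<ge> 0" "thr n \<le> l" "l < thr (Suc n)"
  shows "eventually (\<lambda>x. tau a b x = n + 3) (at_right l)"
proof -
  have "tau a b x = n + 3" if "x \<in> {l <..< thr (Suc n)}" for x
    using that assms by (subst tau_eq_iff) auto
  then show ?thesis
    using eventually_at_right_real[OF assms(3)] by (auto elim: eventually_mono)
qed

lemma has_jump_tau_iff:
  assumes l: "l > 0"
  shows "has_jump (\<lambda>x. real (tau a b x)) l h \<longleftrightarrow> (\<exists>n. l = thr (Suc n)) \<and> h = 1"
proof -
  obtain n where n: "tau a b l = n + 3" using tau_ge_3[OF assms] nat_le_iff_add by (metis add.commute)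
  then have thr: "thr n < l" "l \<le> thr (Suc n)" using tau_eq_iff[OF assms] by auto
  have left: "((\<lambda>x. real (tau a b x)) \<longlongrightarrow> real (n + 3)) (at_left l)"
    using tau_at_left[OF l] n by (intro tendsto_eventually) (auto elim: eventually_mono)
  have thr_iff: "(\<exists>m. l = thr (Suc m)) \<longleftrightarrow> l = thr (Suc n)"
  proof
    assume "\<exists>m. l = thr (Suc m)"
    then obtain m where m: "l = thr (Suc m)" by blast
    then have "n < Suc m" "Suc m \<le> Suc n"
      using thr strict_mono_less[OF thr_strict_mono] strict_mono_less_eq[OF thr_strict_mono] by auto
    then have "m = n" by simp
    with m show "l = thr (Suc n)" by simp
  qed blast
  \<comment> \<open>The right limit belongs to the next level exactly when \<open>l\<close> is the
    closed right end of its constancy interval.\<close>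
  define N where "N = (if l = thr (Suc n) then Suc n else n)"
  have "thr N \<le> l" "l < thr (Suc N)"
    using thr strict_mono_less[OF thr_strict_mono, of "Suc n" "Suc (Suc n)"] by (auto simp: N_def)
  then have right: "((\<lambda>x. real (tau a b x)) \<longlongrightarrow> real (N + 3)) (at_right l)"
    using tau_at_right[of l N] l by (intro tendsto_eventually) (auto elim: eventually_mono)
  have "has_jump (\<lambda>x. real (tau a b x)) l h \<longleftrightarrow>
      real (n + 3) \<noteq> real (N + 3) \<and> h = real (N + 3) - real (n + 3)"
    unfolding has_jump_def
    using left right tendsto_unique[OF trivial_limit_at_left_real left]
      tendsto_unique[OF trivial_limit_at_right_real right] by blast
  also have "\<dots> \<longleftrightarrow> l = thr (Suc n) \<and> h = 1" by (auto simp: N_def)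
  finally show ?thesis using thr_iff by simp
qed

lemma tau_piecewise_constant: "piecewise_constant_on {0<..} (tau a b)"
  unfolding piecewise_constant_on_def
proof (intro exI[of _ "range thr"] conjI allI impI)
  fix x y :: real
  \<comment> \<open>A positive length beyond \<open>y\<close>: every threshold up to
    \<open>y\<close> lies below it, so its index is bounded by the value of \<open>tau\<close>
    there.\<close>
  define l where "l = max 1 (y + 1)"
  have "l > 0" by (simp add: l_def)
  then have "thr n < l \<Longrightarrow> n \<le> tau a b l" for n
    using tau_ge_iff[of l n] by simp
  then have "range thr \<inter> {x..y} \<subseteq> thr ` {..tau a b l}"
    by (fastforce simp: l_def)
  then show "finite (range thr \<inter> {x..y})" by (rule finite_subset) simp
next
  fix I assume I: "is_interval I \<and> I \<subseteq> {0<..} - range thr"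
  have le: "tau a b x = tau a b y" if "x \<in> I" "y \<in> I" "x < y" for x y
  proof -
    have xy: "x > 0" "y > 0" using I that by auto
    obtain n where n: "tau a b x = n + 3"
      using tau_ge_3[OF xy(1)] nat_le_iff_add by (metis add.commute)
    then have thr: "thr n < x" "x \<le> thr (Suc n)" using tau_eq_iff[OF xy(1)] by auto
    have "\<not> thr (Suc n) \<le> y"
    proof
      assume "thr (Suc n) \<le> y"
      then have "thr (Suc n) \<in> I" using I thr that unfolding is_interval_1 by blast
      with I show False by blast
    qed
    then show ?thesis using thr that n tau_eq_iff[OF xy(2), of n] by auto
  qed
  then have "tau a b x = tau a b y" if "x \<in> I" "y \<in> I" for x y
    using that by (metis linorder_neqE)
  then show "tau a b constant_on I"
    unfolding constant_on_def by blast
qed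

end

theorem theorem1:
  fixes a b :: real
  assumes "a > 0" and "b > 0" and "a \<ge> b"
  shows "(\<forall>l>0. int (tau a b l) = i_star a b l + j_star a b l - 1)
    \<and> (\<forall>l>0. tau a b l \<ge> 1)
    \<and> piecewise_constant_on {0<..} (tau a b)
    \<and> (\<forall>l>0. continuous (at_left l) (tau a b))
    \<and> (\<forall>l>0. \<forall>h. has_jump (\<lambda>x. real (tau a b x)) l h \<longrightarrow> h = 1)
    \<and> (\<forall>l>0. (\<exists>h. has_jump (\<lambda>x. real (tau a b x)) l h) \<longleftrightarrow> (\<exists>t\<ge>4. l = lambda a b t))
    \<and> (\<forall>l>0. \<forall>t\<ge>4. l = lambda a b t \<longrightarrow>
          tau a b l = t - 1 \<and> ((\<lambda>\<delta>. tau a b (l + \<delta>)) \<longlongrightarrow> t) (at_right 0))"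
proof -
  interpret grid a b using assms by unfold_locales
  \<comment> \<open>Jumps start at \<open>t = 4\<close> because \<open>t = 3\<close> corresponds to
    \<open>thr 0 = 0\<close>, which is not a positive length.\<close>
  have lambda_Suc: "lambda a b (n + 4) = thr (Suc n)" for n
    using lambda_eq[of "Suc n"] by (simp add: numeral_eq_Suc)
  have ex4: "(\<exists>t\<ge>4. P t) \<longleftrightarrow> (\<exists>n. P (n + 4))" for P :: "nat \<Rightarrow> bool"
    by (metis add.commute le_add1 le_iff_add)
  show ?thesis
  proof (intro conjI allI impI)
    fix l :: real assume l: "l > 0"
    show "int (tau a b l) = i_star a b l + j_star a b l - 1"
      by (rule tau_formula[OF l assms(3)])
    show "tau a b l \<ge> 1" using tau_ge_3[OF l] by simp
    show "continuous (at_left l) (tau a b)"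
      unfolding continuous_within by (rule tendsto_eventually[OF tau_at_left[OF l]])
    show "(\<exists>h. has_jump (\<lambda>x. real (tau a b x)) l h) \<longleftrightarrow> (\<exists>t\<ge>4. l = lambda a b t)"
      unfolding ex4 has_jump_tau_iff[OF l] lambda_Suc by simp
    show "h = 1" if "has_jump (\<lambda>x. real (tau a b x)) l h" for h
      using that has_jump_tau_iff[OF l] by simp
    fix t :: nat assume "t \<ge> 4" and lt: "l = lambda a b t"
    then obtain n where t: "t = n + 4" by (metis add.commute le_iff_add)
    have thr: "l = thr (Suc n)" using lt lambda_Suc t by simp
    then show "tau a b l = t - 1"
      using tau_eq_iff[OF l, of n] strict_monoD[OF thr_strict_mono, of n "Suc n"] t by simp
    have "eventually (\<lambda>x. tau a b x = t) (at_right l)"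
      using tau_at_right[of l "Suc n"] l thr strict_monoD[OF thr_strict_mono, of "Suc n" "Suc (Suc n)"] t
      by (simp add: add.commute)
    then have "(tau a b \<longlongrightarrow> t) (at_right l)" by (rule tendsto_eventually)
    then show "((\<lambda>\<delta>. tau a b (l + \<delta>)) \<longlongrightarrow> t) (at_right 0)"
      unfolding filterlim_at_right_to_0[of _ _ l] by (simp add: add.commute)
  qed (rule tau_piecewise_constant)
qed

end
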